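(* Let $H_n$ denote $\mathbb{R}^n$ or $\mathbb{C}^n$, and let $F=\{f_i\}_{i\in I}\subseteq H_n$, $I=\{1,\dots,k\}$, be a unit-norm frame. Then $F$ has no prime strict scalings if and only if the empty cover $EC(\mathbb{S}_F)$ of its scalability poset can be partitioned into two disjoint sets $A$ and $B$ so that $\bigcup_{K\in A}K$ and $\bigcup_{K\in B}K$ are disjoint sets of indices.
   Context: A frame for $H_n$ is a finite sequence spanning $H_n$; it is unit-norm if each vector has norm $1$. It is tight if there is $\lambda>0$ with $\sum_i|\langle x,f_i\rangle|^2=\lambda\|x\|^2$ for all $x\in H_n$, and Parseval if this holds with $\lambda=1$. A scaling of $F=\{f_i\}_{i=1}^k$ is a vector $w=(w(1),\dots,w(k))\in\mathbb{R}_{\ge0}^k$ such that $\{\sqrt{w(i)}f_i\}_{i\in I}$ is a Parseval frame for $H_n$; a frame is scalable if it has a scaling. A scaling is strict if all of its entries are strictly positive. A scaling is prime if the scaled frame does not contain any proper tight subframe, and non-prime otherwise. The scalability poset of $F$ is $\mathbb{S}_F=\{J\subseteq I:\{f_j\}_{j\in J}\text{ is a scalable frame for }H_n\}$, ordered by inclusion, with the convention $\emptyset\in\mathbb{S}_F$. Its empty cover $EC(\mathbb{S}_F)$ is the set of all nonempty $J\in\mathbb{S}_F$ for which there is no $J'\in\mathbb{S}_F$ with $\emptyset\subsetneq J'\subsetneq J$.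
   Formalization: It is additionally assumed that F has at least one strict scaling; without this the claim fails, e.g. for {e1, e2, (e1+e2)/√2} in R^2, which has no strict scalings while its empty cover {{1,2}} cannot be split. Both A and B are required to be nonempty. *)

theory Defs
  imports "HOL-Analysis.Analysis" "Jordan_Normal_Form.Conjugate"
begin

(* Real and complex vectors are treated uniformly: conjugate is the identity on real and cnj on
   complex. The library's inner is not suitable here, since on complex vectors it is only the real
   part of the Hermitian inner product. *)
definition hinner :: "'a::conjugatable_field ^ 'n \<Rightarrow> 'a ^ 'n \<Rightarrow> 'a" where
  "hinner x y = (\<Sum>i\<in>UNIV. x $ i * conjugate (y $ i))"

(* A finite sequence is a finite index set J with a family f; subsequences are given by subsets of
   J, so repeated vectors are counted with multiplicity. The span is over the scalar field 'a. *)
definition frame :: "'i set \<Rightarrow> ('i \<Rightarrow> 'a::field ^ 'n) \<Rightarrow> bool" where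
  "frame J f \<longleftrightarrow> finite J \<and> vec.span (f ` J) = UNIV"

definition unit_norm_frame :: "'i set \<Rightarrow> ('i \<Rightarrow> 'a::real_normed_field ^ 'n) \<Rightarrow> bool" where
  "unit_norm_frame J f \<longleftrightarrow> frame J f \<and> (\<forall>i\<in>J. norm (f i) = 1)"

definition tight_frame ::
  "'i set \<Rightarrow> ('i \<Rightarrow> 'a::{real_normed_field, conjugatable_field} ^ 'n) \<Rightarrow> bool" where
  "tight_frame J f \<longleftrightarrow> frame J f \<and>
     (\<exists>c>0. \<forall>x. (\<Sum>i\<in>J. (norm (hinner x (f i)))\<^sup>2) = c * (norm x)\<^sup>2)"

definition parseval_frame ::
  "'i set \<Rightarrow> ('i \<Rightarrow> 'a::{real_normed_field, conjugatable_field} ^ 'n) \<Rightarrow> bool" where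
  "parseval_frame J f \<longleftrightarrow> frame J f \<and>
     (\<forall>x. (\<Sum>i\<in>J. (norm (hinner x (f i)))\<^sup>2) = (norm x)\<^sup>2)"

definition scaled ::
  "('i \<Rightarrow> real) \<Rightarrow> ('i \<Rightarrow> 'a::real_normed_field ^ 'n) \<Rightarrow> 'i \<Rightarrow> 'a ^ 'n" where
  "scaled w f = (\<lambda>i. sqrt (w i) *\<^sub>R f i)"

(* A vector of weights indexed by J is a function whose values outside J are irrelevant. *)
definition scaling ::
  "'i set \<Rightarrow> ('i \<Rightarrow> 'a::{real_normed_field, conjugatable_field} ^ 'n) \<Rightarrow> ('i \<Rightarrow> real) \<Rightarrow> bool" where
  "scaling J f w \<longleftrightarrow> (\<forall>i\<in>J. 0 \<le> w i) \<and> parseval_frame J (scaled w f)"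

definition strict_scaling ::
  "'i set \<Rightarrow> ('i \<Rightarrow> 'a::{real_normed_field, conjugatable_field} ^ 'n) \<Rightarrow> ('i \<Rightarrow> real) \<Rightarrow> bool" where
  "strict_scaling J f w \<longleftrightarrow> scaling J f w \<and> (\<forall>i\<in>J. 0 < w i)"

definition prime_scaling ::
  "'i set \<Rightarrow> ('i \<Rightarrow> 'a::{real_normed_field, conjugatable_field} ^ 'n) \<Rightarrow> ('i \<Rightarrow> real) \<Rightarrow> bool" where
  "prime_scaling J f w \<longleftrightarrow> scaling J f w \<and> \<not> (\<exists>K. K \<subset> J \<and> tight_frame K (scaled w f))"

definition scalable_frame ::
  "'i set \<Rightarrow> ('i \<Rightarrow> 'a::{real_normed_field, conjugatable_field} ^ 'n) \<Rightarrow> bool" where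
  "scalable_frame J f \<longleftrightarrow> frame J f \<and> (\<exists>w. scaling J f w)"

definition scalability_poset ::
  "'i set \<Rightarrow> ('i \<Rightarrow> 'a::{real_normed_field, conjugatable_field} ^ 'n) \<Rightarrow> 'i set set" where
  "scalability_poset I f = {J. J \<subseteq> I \<and> (J = {} \<or> scalable_frame J f)}"

definition empty_cover :: "'i set set \<Rightarrow> 'i set set" where
  "empty_cover S = {J \<in> S. J \<noteq> {} \<and> \<not> (\<exists>J'\<in>S. {} \<subset> J' \<and> J' \<subset> J)}"

(* The blocks of a partition are nonempty; otherwise A = C, B = {} would always qualify. *)
definition index_disjoint_partition :: "'i set set \<Rightarrow> 'i set set \<Rightarrow> 'i set set \<Rightarrow> bool" where
  "index_disjoint_partition C A B \<longleftrightarrow>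
     A \<noteq> {} \<and> B \<noteq> {} \<and> A \<union> B = C \<and> A \<inter> B = {} \<and> \<Union>A \<inter> \<Union>B = {}"

end

theory Submission
  imports Defs
begin

text \<open>Scalings are the nonnegative solutions of a linear system, and the empty cover consists of
  the supports of its minimal solutions.  Subtracting multiples of minimal solutions writes every
  solution as a nonnegative combination of them; if the supports split into two index-disjoint
  classes, then restricting to one class preserves tightness, so no strict scaling is prime.
  Conversely, the weights whose restriction to a fixed index set is tight form a linear subspace.
  If none of these finitely many subspaces contains all scalings, then a generic strict scaling
  avoids them all and is prime; and a proper nonempty index set whose subspace contains all
  scalings splits the empty cover, by minimality.\<close>

section \<open>Nonnegative solutions of a linear system\<close>

text \<open>The model is |<x, f_i>|^2 for \<open>a i x\<close> and |x|^2 for \<open>b x\<close>,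
  with one equation for every vector x.\<close>

locale nonneg_system =
  fixes I :: "'i set" and a :: "'i \<Rightarrow> 'x \<Rightarrow> real" and b :: "'x \<Rightarrow> real"
  assumes finite_I: "finite I"
    and a_nonneg: "\<And>i x. i \<in> I \<Longrightarrow> 0 \<le> a i x"
    and a_nonzero: "\<And>i. i \<in> I \<Longrightarrow> \<exists>x. 0 < a i x"
    and b_nonneg: "\<And>x. 0 \<le> b x"
    and b_nonzero: "\<exists>x. 0 < b x"
begin

text \<open>The constant \<open>c\<close> and the signs of \<open>w\<close> are left free, so that
  for fixed \<open>K\<close> the weights balanced with some \<open>c\<close> form a linear subspace.
  For nonnegative weights, tightness is the case \<open>0 < c\<close> and the Parseval property the
  case \<open>c = 1\<close>.\<close>

definition balanced :: "'i set \<Rightarrow> ('i \<Rightarrow> real) \<Rightarrow> real \<Rightarrow> bool" where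
  "balanced K w c \<longleftrightarrow> (\<forall>x. (\<Sum>i\<in>K. w i * a i x) = c * b x)"

definition solvable :: "'i set set" where
  "solvable = {J. J \<subseteq> I \<and> (J = {} \<or> (\<exists>w. (\<forall>i\<in>J. 0 \<le> w i) \<and> balanced J w 1))}"

section \<open>Linearity and positivity of balanced weights\<close>

lemma balanced_combine:
  assumes "balanced K w c" "balanced K v d"
  shows "balanced K (\<lambda>i. p * w i + q * v i) (p * c + q * d)"
  using assms unfolding balanced_def
  by (simp add: distrib_right sum.distrib mult.assoc flip: sum_distrib_left)

lemma balanced_cong:
  assumes "\<And>i. i \<in> K \<Longrightarrow> w i = v i"
  shows "balanced K w c \<longleftrightarrow> balanced K v c"
  using assms by (simp add: balanced_def)

lemma balanced_superset:
  assumes "finite K" "L \<subseteq> K" "\<forall>i\<in>K - L. w i = 0"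
  shows "balanced K w c \<longleftrightarrow> balanced L w c"
proof -
  have "(\<Sum>i\<in>K. w i * a i x) = (\<Sum>i\<in>L. w i * a i x)" for x
    by (rule sum.mono_neutral_right) (use assms in auto)
  then show ?thesis by (simp add: balanced_def)
qed

text \<open>At an \<open>x\<close> with \<open>0 < a j x\<close> the weighted sum is positive, so
  \<open>c * b x\<close> is positive while \<open>b x\<close> is nonnegative.\<close>

lemma balanced_pos:
  assumes "K \<subseteq> I" "\<And>i. i \<in> K \<Longrightarrow> 0 \<le> w i" "j \<in> K" "0 < w j" "balanced K w c"
  shows "0 < c"
proof -
  obtain x where x: "0 < a j x" using a_nonzero assms by blast
  have "0 < (\<Sum>i\<in>K. w i * a i x)"
    by (rule sum_pos2[of _ j])
      (use assms x a_nonneg finite_I in \<open>auto intro: finite_subset mult_nonneg_nonneg\<close>)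
  then have "0 < c * b x" using assms by (simp add: balanced_def)
  then show ?thesis using b_nonneg[of x] by (simp add: zero_less_mult_iff)
qed

lemma balanced_nonempty:
  assumes "balanced K w c" "0 < c"
  shows "K \<noteq> {}"
  using assms b_nonzero by (auto simp: balanced_def)

lemma solvableI:
  assumes "K \<subseteq> I" "\<And>i. i \<in> K \<Longrightarrow> 0 \<le> w i" "balanced K w c" "0 < c"
  shows "K \<in> solvable"
proof -
  \<comment> \<open>The coefficient 0 discards the second summand; what remains is rescaling by
    \<open>1 / c\<close>.\<close>
  have "balanced K (\<lambda>i. (1 / c) * w i + 0 * w i) ((1 / c) * c + 0 * c)"
    by (rule balanced_combine) (use assms in auto)
  then have "balanced K (\<lambda>i. w i / c) 1" using assms by simp
  moreover have "\<forall>i\<in>K. 0 \<le> w i / c" using assms by simp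
  ultimately show ?thesis using assms(1) unfolding solvable_def
    by (intro CollectI conjI disjI2 exI)
qed

section \<open>Minimal solvable sets\<close>

lemma empty_cover_below:
  assumes "J \<in> solvable" "J \<noteq> {}"
  obtains J' where "J' \<in> empty_cover solvable" "J' \<subseteq> J"
proof -
  have "finite J" using assms finite_I by (auto simp: solvable_def intro: finite_subset)
  then have "\<exists>J'\<in>empty_cover solvable. J' \<subseteq> J" using assms
  proof (induction J rule: finite_psubset_induct)
    case (psubset J)
    show ?case
    proof (cases "J \<in> empty_cover solvable")
      case True
      then show ?thesis by blast
    next
      case False
      then obtain J' where "J' \<in> solvable" "J' \<noteq> {}" "J' \<subset> J"
        using psubset.prems by (auto simp: empty_cover_def)
      then show ?thesis using psubset.IH[of J'] by blast
    qed
  qed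
  then show ?thesis using that by blast
qed

text \<open>The support of a nonnegative solution on \<open>J\<close> is itself solvable and
  nonempty, so minimality forces it to be all of \<open>J\<close>.\<close>

lemma empty_cover_solution:
  assumes "J \<in> empty_cover solvable"
  obtains u where "\<And>i. i \<in> J \<Longrightarrow> 0 < u i" "balanced J u 1"
proof -
  obtain w where w: "\<forall>i\<in>J. 0 \<le> w i" "balanced J w 1" and J: "J \<subseteq> I"
    using assms by (auto simp: empty_cover_def solvable_def)
  define L where "L = {i\<in>J. 0 < w i}"
  have bal: "balanced L w 1"
  proof (rule balanced_superset[THEN iffD1, OF _ _ _ w(2)])
    show "finite J" using finite_subset[OF J finite_I] .
    show "L \<subseteq> J" by (auto simp: L_def)
    show "\<forall>i\<in>J - L. w i = 0" using w(1) by (force simp: L_def)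
  qed
  have "L \<in> solvable"
    by (rule solvableI[where w=w and c=1]) (use bal J in \<open>auto simp: L_def\<close>)
  moreover have "L \<noteq> {}" "L \<subseteq> J" using balanced_nonempty[OF bal] by (auto simp: L_def)
  ultimately have "L = J" using assms by (auto simp: empty_cover_def)
  then show ?thesis using that[of w] bal by (auto simp: L_def)
qed

section \<open>Decomposition into minimal solutions\<close>

text \<open>Subtracting the largest admissible multiple of a minimal solution makes some weight
  vanish, which allows induction on the support. Restriction to \<open>U\<close> either keeps a
  minimal solution whole or annihilates it, so balance survives; \<open>d\<close> may be 0.\<close>

lemma balanced_restrict:
  assumes split: "\<And>J. J \<in> empty_cover solvable \<Longrightarrow> J \<subseteq> U \<or> J \<inter> U = {}"
    and "K \<subseteq> I" "\<And>i. i \<in> K \<Longrightarrow> 0 < w i" "balanced K w c"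
  shows "\<exists>d. balanced (K \<inter> U) w d"
proof -
  have "finite K" using assms(2) finite_I finite_subset by blast
  then show ?thesis using assms(2-4)
  proof (induction K arbitrary: w c rule: finite_psubset_induct)
    case (psubset K)
    show ?case
    proof (cases "K = {}")
      case True
      then show ?thesis by (auto simp: balanced_def intro: exI[of _ 0])
    next
      case False
      then have "0 < c"
        using balanced_pos[of K w] psubset.prems by (metis ex_in_conv less_imp_le)
      then have "K \<in> solvable"
        using solvableI[of K w c] psubset.prems by (simp add: less_imp_le)
      then obtain J where J: "J \<in> empty_cover solvable" "J \<subseteq> K"
        using empty_cover_below False by blast
      obtain u where u: "\<And>i. i \<in> J \<Longrightarrow> 0 < u i" "balanced J u 1"
        using empty_cover_solution[OF J(1)] by blast
      have J_fin: "finite J" "J \<noteq> {}"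
        using J psubset.hyps finite_subset by (auto simp: empty_cover_def)
      \<comment> \<open>The largest multiple of \<open>u\<close> that can be subtracted with all
        weights staying nonnegative. At an index \<open>j\<close> attaining the minimum the new
        weight is 0, so the support shrinks strictly.\<close>
      define t where "t = Min ((\<lambda>i. w i / u i) ` J)"
      have "t \<in> (\<lambda>i. w i / u i) ` J" unfolding t_def using J_fin by (intro Min_in) auto
      then obtain j where j: "j \<in> J" "t = w j / u j" by blast
      have t_le: "t \<le> w i / u i" if "i \<in> J" for i
        unfolding t_def using J_fin that by (intro Min_le) auto
      define v where "v = (\<lambda>i. if i \<in> J then u i else 0)"
      define w' where "w' = (\<lambda>i. w i - t * v i)"
      have vK: "balanced K v 1"
        using balanced_superset[of K J v 1] balanced_cong[of J v u 1] J u(2) psubset.hyps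
        by (auto simp: v_def)
      have w'_nonneg: "0 \<le> w' i" if "i \<in> K" for i
        using t_le[of i] u(1)[of i] psubset.prems(2)[OF that]
        by (auto simp: w'_def v_def field_simps)
      have w'K: "balanced K w' (c - t)"
        using balanced_combine[OF psubset.prems(3) vK, of 1 "- t"] by (simp add: w'_def)
      define L where "L = {i\<in>K. 0 < w' i}"
      have zero: "\<forall>i\<in>K - L. w' i = 0"
        using w'_nonneg by (force simp: L_def)
      have "j \<notin> L" using j u(1)[of j] by (simp add: L_def w'_def v_def)
      then have "L \<subset> K" using j J by (auto simp: L_def)
      moreover have "balanced L w' (c - t)"
        by (rule balanced_superset[THEN iffD1, OF psubset.hyps _ zero w'K]) (auto simp: L_def)
      moreover have "L \<subseteq> I" "\<And>i. i \<in> L \<Longrightarrow> 0 < w' i"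
        using psubset.prems(1) by (auto simp: L_def)
      ultimately obtain d where "balanced (L \<inter> U) w' d"
        using psubset.IH[of L w' "c - t"] by blast
      then have w'U: "balanced (K \<inter> U) w' d"
        by (rule balanced_superset[THEN iffD2, rotated 3])
          (use zero psubset.hyps \<open>L \<subset> K\<close> in blast)+
      \<comment> \<open>By \<open>split\<close>, the minimal solution restricted to \<open>U\<close>
        is either unchanged, with constant 1, or zero, with constant 0.\<close>
      have "\<exists>e. balanced (K \<inter> U) v e"
      proof (cases "J \<subseteq> U")
        case True
        then have "balanced (K \<inter> U) v 1"
          using balanced_superset[of "K \<inter> U" J v 1] balanced_cong[of J v u 1] J(2) u(2) psubset.hyps
          by (simp add: v_def)
        then show ?thesis ..
      next
        case False
        then have "J \<inter> U = {}" using split J(1) by blast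
        then have "balanced (K \<inter> U) v 0" by (auto simp: balanced_def v_def intro!: sum.neutral)
        then show ?thesis ..
      qed
      then obtain e where "balanced (K \<inter> U) v e" ..
      from balanced_combine[OF w'U this, of 1 t] show ?thesis by (simp add: w'_def) blast
    qed
  qed
qed

section \<open>Generic solutions\<close>

text \<open>A line that meets a linear subspace at two distinct parameters lies in it. Since one of
  the endpoints \<open>w\<close>, \<open>v\<close> is outside, at most one parameter is
  possible.\<close>

lemma finite_balanced_line:
  assumes "\<not> ((\<exists>c. balanced K w c) \<and> (\<exists>c. balanced K v c))"
  shows "finite {t. \<exists>c. balanced K (\<lambda>i. (1 - t) * w i + t * v i) c}" (is "finite ?T")
proof -
  have "s = t" if s: "s \<in> ?T" and t: "t \<in> ?T" for s t
  proof (rule ccontr)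
    assume ne: "s \<noteq> t"
    obtain c d where c: "balanced K (\<lambda>i. (1 - s) * w i + s * v i) c"
      and d: "balanced K (\<lambda>i. (1 - t) * w i + t * v i) d"
      using s t by blast
    \<comment> \<open>Cramer's rule: the coefficient rows (1 - s, s) and (1 - t, t) have determinant
      \<open>t - s\<close>, so \<open>w\<close> and \<open>v\<close> are recovered from the two
      points on the line.\<close>
    define r where "r = 1 / (t - s)"
    have r: "r * (t - s) = 1" using ne by (simp add: r_def)
    have "r * t * ((1 - s) * w i + s * v i) + - (r * s) * ((1 - t) * w i + t * v i)
        = r * (t - s) * w i" for i
      by (simp add: algebra_simps)
    then have "balanced K w (r * t * c + - (r * s) * d)"
      using balanced_combine[OF c d, of "r * t" "- (r * s)"] by (simp only: r mult_1)
    moreover have "- (r * (1 - t)) * ((1 - s) * w i + s * v i)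
        + r * (1 - s) * ((1 - t) * w i + t * v i) = r * (t - s) * v i" for i
      by (simp add: algebra_simps)
    then have "balanced K v (- (r * (1 - t)) * c + r * (1 - s) * d)"
      using balanced_combine[OF c d, of "- (r * (1 - t))" "r * (1 - s)"] by (simp only: r mult_1)
    ultimately show False using assms by blast
  qed
  then have "is_singleton ?T \<or> ?T = {}"
    by (intro disjCI is_singletonI') blast+
  then show ?thesis by (auto elim: is_singletonE)
qed

text \<open>Induction on the family: the current strict solution is moved slightly along the segment
  to a solution that escapes the new set. Convex combination preserves the constant 1.\<close>

lemma generic_solution:
  assumes "finite \<K>" "\<And>i. i \<in> I \<Longrightarrow> 0 < w\<^sub>0 i" "balanced I w\<^sub>0 1"
    and "\<And>K. K \<in> \<K> \<Longrightarrow>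
      \<exists>v. (\<forall>i\<in>I. 0 \<le> v i) \<and> balanced I v 1 \<and> \<not> (\<exists>c. balanced K v c)"
  shows "\<exists>w. (\<forall>i\<in>I. 0 < w i) \<and> balanced I w 1 \<and> (\<forall>K\<in>\<K>. \<not> (\<exists>c. balanced K w c))"
  using assms(1,4)
proof (induction \<K>)
  case empty
  then show ?case using assms(2,3) by auto
next
  case (insert K \<K>)
  obtain w where w: "\<forall>i\<in>I. 0 < w i" "balanced I w 1" "\<forall>L\<in>\<K>. \<not> (\<exists>c. balanced L w c)"
    using insert.IH insert.prems by blast
  obtain v where v: "\<forall>i\<in>I. 0 \<le> v i" "balanced I v 1" "\<not> (\<exists>c. balanced K v c)"
    using insert.prems by blast
  \<comment> \<open>For the old sets the endpoint \<open>w\<close> escapes, for the new set the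
    endpoint \<open>v\<close> does; so each excludes only finitely many parameters. Taking
    \<open>t < 1\<close> keeps all weights positive.\<close>
  define bad where "bad = (\<lambda>L. {t. \<exists>c. balanced L (\<lambda>i. (1 - t) * w i + t * v i) c})"
  have "finite (\<Union>L\<in>insert K \<K>. bad L)"
    unfolding bad_def using insert.hyps w(3) v(3)
    by (intro finite_UN_I finite_balanced_line) auto
  moreover have "infinite {0<..<1::real}" by simp
  ultimately obtain t where t: "t \<in> {0<..<1}" "t \<notin> (\<Union>L\<in>insert K \<K>. bad L)"
    by (meson finite_subset subsetI)
  let ?u = "\<lambda>i. (1 - t) * w i + t * v i"
  have "\<forall>i\<in>I. 0 < ?u i" using t(1) w(1) v(1) by (auto intro!: add_pos_nonneg)
  moreover have "balanced I ?u 1" using balanced_combine[OF w(2) v(2), of "1 - t" t] by simp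
  moreover have "\<forall>L\<in>insert K \<K>. \<not> (\<exists>c. balanced L ?u c)"
    using t(2) by (auto simp: bad_def)
  ultimately show ?case by (intro exI[of _ ?u] conjI)
qed

section \<open>Partitions of the empty cover\<close>

text \<open>The balanced subset is the union of \<open>A\<close>: every minimal set lies inside it
  or misses it. It is nonempty because \<open>A\<close> is, and proper because \<open>B\<close> has
  a nonempty member.\<close>

lemma partition_imp_balanced_subset:
  assumes part: "index_disjoint_partition (empty_cover solvable) A B"
    and w: "\<And>i. i \<in> I \<Longrightarrow> 0 < w i" "balanced I w 1"
  shows "\<exists>K\<subset>I. \<exists>c>0. balanced K w c"
proof -
  have AB: "A \<union> B = empty_cover solvable" "\<Union>A \<inter> \<Union>B = {}" "A \<noteq> {}" "B \<noteq> {}"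
    using part by (auto simp: index_disjoint_partition_def)
  have EC: "J \<subseteq> I" "J \<noteq> {}" if "J \<in> A \<union> B" for J
    using that unfolding AB(1) by (auto simp: empty_cover_def solvable_def)
  obtain J L where JL: "J \<in> A" "L \<in> B"
    using AB by blast
  have "J \<subseteq> \<Union>A \<or> J \<inter> \<Union>A = {}" if "J \<in> empty_cover solvable" for J
    using that AB(2) unfolding AB(1)[symmetric] by blast
  then have "\<exists>d. balanced (I \<inter> \<Union>A) w d"
    using balanced_restrict[OF _ subset_refl w] by blast
  moreover have IA: "I \<inter> \<Union>A = \<Union>A" using EC by blast
  ultimately obtain d where d: "balanced (\<Union>A) w d" by auto
  obtain j where j: "j \<in> \<Union>A" using JL EC by blast
  have "0 < d"
    by (rule balanced_pos[OF _ _ j _ d]) (use IA w(1) j in \<open>blast intro: less_imp_le\<close>)+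
  moreover have "\<Union>A \<subset> I"
    using AB(2) EC[of L] JL(2) IA by blast
  ultimately show ?thesis using d by blast
qed

lemma balanced_complement:
  assumes "K \<subseteq> I" "balanced I w c" "balanced K w d"
  shows "balanced (I - K) w (c - d)"
  using assms finite_I by (simp add: balanced_def sum_diff finite_subset left_diff_distrib)

text \<open>The minimal sets are sorted into those inside \<open>K\<close> and those inside
  \<open>I - K\<close>. Both classes are inhabited because \<open>w\<close> is positive and balanced
  on each side.\<close>

lemma common_balanced_subset_imp_partition:
  assumes w: "\<And>i. i \<in> I \<Longrightarrow> 0 < w i" "balanced I w 1"
    and K: "K \<subset> I" "K \<noteq> {}"
    and all: "\<And>v. (\<And>i. i \<in> I \<Longrightarrow> 0 \<le> v i) \<Longrightarrow> balanced I v 1 \<Longrightarrow> \<exists>c. balanced K v c"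
  shows "\<exists>A B. index_disjoint_partition (empty_cover solvable) A B"
proof -
  have below: "\<exists>J\<in>empty_cover solvable. J \<subseteq> M"
    if M: "M \<subseteq> I" "M \<noteq> {}" "balanced M w c" for M c
  proof -
    obtain j where "j \<in> M" using M by blast
    then have "0 < c"
      using balanced_pos[of M w j c] M w(1) by (meson less_imp_le subset_iff)
    then have "M \<in> solvable" using solvableI[of M w c] M w(1) by (meson less_imp_le subset_iff)
    then show ?thesis using empty_cover_below M(2) by blast
  qed
  obtain d where d: "balanced K w d" using all[of w] w by (meson less_imp_le)
  \<comment> \<open>If \<open>K\<close> cut \<open>J\<close>, restricting the zero-extended minimal
    solution to \<open>K\<close> would make \<open>J \<inter> K\<close> a smaller nonempty solvable
    set.\<close>
  have split: "J \<subseteq> K \<or> J \<subseteq> I - K" if J: "J \<in> empty_cover solvable" for J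
  proof (rule ccontr)
    assume cut: "\<not> (J \<subseteq> K \<or> J \<subseteq> I - K)"
    have JI: "J \<subseteq> I" using J by (auto simp: empty_cover_def solvable_def)
    obtain u where u: "\<And>i. i \<in> J \<Longrightarrow> 0 < u i" "balanced J u 1"
      using empty_cover_solution[OF J] by blast
    define v where "v = (\<lambda>i. if i \<in> J then u i else 0)"
    have "balanced I v 1"
      using balanced_superset[of I J v 1] balanced_cong[of J v u 1] JI u(2) finite_I
      by (auto simp: v_def)
    moreover have v_nonneg: "0 \<le> v i" for i using u(1) by (auto simp: v_def less_imp_le)
    ultimately obtain c where "balanced K v c" using all by blast
    then have c: "balanced (J \<inter> K) v c"
      by (rule balanced_superset[THEN iffD1, rotated 3])
        (use K finite_I in \<open>auto simp: v_def intro: finite_subset\<close>)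
    obtain j where j: "j \<in> J \<inter> K" using cut JI by blast
    have "0 < v j" using u(1) j by (simp add: v_def)
    then have "0 < c" using balanced_pos[OF _ _ j _ c] JI v_nonneg by blast
    then have "J \<inter> K \<in> solvable"
      using solvableI[OF _ _ c] JI v_nonneg by blast
    moreover have "{} \<subset> J \<inter> K" "J \<inter> K \<subset> J" using j cut by auto
    ultimately show False using J by (auto simp: empty_cover_def)
  qed
  define A where "A = {J\<in>empty_cover solvable. J \<subseteq> K}"
  define B where "B = {J\<in>empty_cover solvable. J \<subseteq> I - K}"
  have "A \<noteq> {}" using below[OF _ _ d] K by (auto simp: A_def)
  moreover have "B \<noteq> {}"
    using below[OF _ _ balanced_complement[OF _ w(2) d]] K by (auto simp: B_def)
  moreover have "A \<union> B = empty_cover solvable" using split by (auto simp: A_def B_def)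
  moreover have "A \<inter> B = {}" by (auto simp: A_def B_def empty_cover_def)
  moreover have "\<Union>A \<inter> \<Union>B = {}" by (auto simp: A_def B_def)
  ultimately show ?thesis unfolding index_disjoint_partition_def by blast
qed

theorem partition_iff:
  assumes w\<^sub>0: "\<And>i. i \<in> I \<Longrightarrow> 0 < w\<^sub>0 i" "balanced I w\<^sub>0 1"
  shows "(\<exists>A B. index_disjoint_partition (empty_cover solvable) A B) \<longleftrightarrow>
    (\<forall>w. (\<forall>i\<in>I. 0 < w i) \<and> balanced I w 1 \<longrightarrow> (\<exists>K\<subset>I. \<exists>c>0. balanced K w c))"
    (is "?L \<longleftrightarrow> ?R")
proof
  assume ?L
  then show ?R using partition_imp_balanced_subset by blast
next
  assume R: ?R
  show ?L
  proof (rule ccontr)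
    assume "\<not> ?L"
    \<comment> \<open>Without a partition, no proper nonempty \<open>K\<close> is balanced for all
      nonnegative solutions; a single strict solution then escapes all these finitely many
      \<open>K\<close>, contradicting \<open>R\<close>.\<close>
    then have escape: "\<exists>v. (\<forall>i\<in>I. 0 \<le> v i) \<and> balanced I v 1 \<and> \<not> (\<exists>c. balanced K v c)"
      if "K \<in> {K. K \<subset> I \<and> K \<noteq> {}}" for K
      using common_balanced_subset_imp_partition[OF w\<^sub>0, of K] that by blast
    have "finite {K. K \<subset> I \<and> K \<noteq> {}}"
      by (rule finite_subset[of _ "Pow I"]) (use finite_I in auto)
    from generic_solution[OF this w\<^sub>0 escape]
    obtain w where w: "\<forall>i\<in>I. 0 < w i" "balanced I w 1"
      "\<forall>K\<in>{K. K \<subset> I \<and> K \<noteq> {}}. \<not> (\<exists>c. balanced K w c)"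
      by blast
    obtain K c where K: "K \<subset> I" "0 < c" "balanced K w c"
      using R[rule_format, of w] w(1,2) by auto
    have "K \<in> {K. K \<subset> I \<and> K \<noteq> {}}" using K(1) balanced_nonempty[OF K(3,2)] by simp
    then show False using w(3) K(3) by (meson bspec)
  qed
qed

end

section \<open>Frames\<close>

text \<open>A linear functional that vanishes on \<open>S\<close> but not at some \<open>z\<close>
  outside the span is represented by a vector \<open>y\<close> through
  \<open>hinner\<close>.\<close>

lemma orthogonal_to_proper_span:
  fixes S :: "('a::conjugatable_field ^ 'n) set"
  assumes "vec.span S \<noteq> UNIV"
  obtains y where "y \<noteq> 0" "\<And>x. x \<in> S \<Longrightarrow> hinner x y = 0"
proof -
  obtain B where B: "B \<subseteq> S" "vec.independent B" "vec.span B = vec.span S"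
    using vec.maximal_independent_subset[of S]
    by (metis vec.span_mono vec.span_span subset_antisym)
  obtain z where z: "z \<notin> vec.span B" using assms B by blast
  have ind: "vec.independent (insert z B)"
    using B z by (simp add: vec.independent_insertI)
  \<comment> \<open>An arbitrary coordinate: the functional is the \<open>j\<close>-th coordinate of
    a linear map \<open>L\<close> sending \<open>z\<close> to the \<open>j\<close>-th unit vector.
    It is represented by the conjugated \<open>j\<close>-th row of the matrix of
    \<open>L\<close>.\<close>
  fix j :: 'n
  obtain L :: "'a ^ 'n \<Rightarrow> 'a ^ 'n" where L: "Vector_Spaces.linear (*s) (*s) L"
    and L_on: "\<forall>x\<in>insert z B. L x = (if x = z then axis j 1 else 0)"
    using vec.linear_independent_extend[OF ind, of "\<lambda>x. if x = z then axis j 1 else 0"] by blast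
  have zB: "z \<notin> B" using z vec.span_base by blast
  have L0: "L x = 0" if "x \<in> S" for x
    by (rule vec.linear_eq_0_on_span[OF L, of B])
      (use L_on zB that B vec.span_base in auto)
  define y where "y = (\<chi> i. conjugate (matrix L $ j $ i))"
  have hy: "hinner x y = L x $ j" for x
  proof -
    have "L x $ j = (matrix L *v x) $ j" by (simp add: matrix_works L)
    then show ?thesis
      by (simp add: hinner_def y_def matrix_vector_mult_def mult.commute)
  qed
  have "hinner z y = 1" using L_on by (simp add: hy axis_def)
  then have "y \<noteq> 0" by (auto simp: hinner_def)
  moreover have "hinner x y = 0" if "x \<in> S" for x using L0[OF that] by (simp add: hy)
  ultimately show ?thesis using that by blast
qed

lemma hinner_commute: "hinner y x = conjugate (hinner x y)"
  for x y :: "'a::conjugatable_field ^ 'n"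
  by (simp add: hinner_def sum_conjugate conjugate_dist_mul mult.commute)

lemma frameI:
  fixes f :: "'i \<Rightarrow> 'a::conjugatable_field ^ 'n"
  assumes "finite J" "\<And>y. (\<And>i. i \<in> J \<Longrightarrow> hinner y (f i) = 0) \<Longrightarrow> y = 0"
  shows "frame J f"
proof (rule ccontr)
  assume "\<not> frame J f"
  then have "vec.span (f ` J) \<noteq> UNIV" using assms(1) by (simp add: frame_def)
  then obtain y where "y \<noteq> 0" "\<And>x. x \<in> f ` J \<Longrightarrow> hinner x y = 0"
    using orthogonal_to_proper_span by blast
  then show False using assms(2)[of y] hinner_commute[of y] by (simp add: conjugate_zero)
qed

section \<open>Frames as an instance of the linear system\<close>

text \<open>Isometry of conjugation is an explicit assumption so that one argument serves real and
  complex scalars; it holds for both.\<close>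

context
  fixes I :: "'i set" and f :: "'i \<Rightarrow> 'a::{real_normed_field, conjugatable_field} ^ 'n"
  assumes norm_conjugate: "\<And>z::'a. norm (conjugate z) = norm z"
    and unit: "unit_norm_frame I f"
begin

interpretation sys: nonneg_system I "\<lambda>i x. (norm (hinner x (f i)))\<^sup>2"
  "\<lambda>x::'a ^ 'n. (norm x)\<^sup>2"
proof
  show "finite I" using unit by (simp add: unit_norm_frame_def frame_def)
  show "\<exists>x. 0 < (norm (hinner x (f i)))\<^sup>2" if "i \<in> I" for i
  proof -
    have "norm (f i) = 1" using unit that by (simp add: unit_norm_frame_def)
    then have "f i \<noteq> 0" by auto
    then obtain j where j: "f i $ j \<noteq> 0" by (auto simp: vec_eq_iff)
    \<comment> \<open>Pairing with a unit vector reads off the conjugate of a nonzero entry of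
      \<open>f i\<close>.\<close>
    have "hinner (axis j 1) (f i) = (\<Sum>l\<in>UNIV. if l = j then conjugate (f i $ l) else 0)"
      unfolding hinner_def by (rule sum.cong) (auto simp: axis_def)
    then have "hinner (axis j 1) (f i) = conjugate (f i $ j)" by simp
    then show ?thesis using j by (intro exI[of _ "axis j 1"]) simp
  qed
  show "\<exists>x::'a ^ 'n. 0 < (norm x)\<^sup>2"
  proof -
    fix j :: 'n
    have "(axis j 1 :: 'a ^ 'n) \<noteq> 0" by (metis axis_eq_0_iff zero_neq_one)
    then show ?thesis by (intro exI[of _ "axis j 1"]) simp
  qed
qed auto

lemma norm_hinner_scaled:
  assumes "0 \<le> w i"
  shows "(norm (hinner x (scaled w f i)))\<^sup>2 = w i * (norm (hinner x (f i)))\<^sup>2"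
proof -
  have "scaled w f i $ j = of_real (sqrt (w i)) * f i $ j" for j
    by (simp only: scaled_def vector_scaleR_component) (simp only: scaleR_conv_of_real)
  then have "hinner x (scaled w f i) = conjugate (of_real (sqrt (w i))) * hinner x (f i)"
    by (simp add: hinner_def sum_distrib_left conjugate_dist_mul mult_ac)
  then show ?thesis using assms by (simp add: norm_mult norm_conjugate power_mult_distrib)
qed

text \<open>A vector \<open>y\<close> orthogonal to every \<open>f i\<close> makes the weighted sum
  vanish, hence \<open>c * (norm y)\<^sup>2 = 0\<close>.\<close>

lemma frame_if_balanced:
  assumes "K \<subseteq> I" "sys.balanced K w c" "0 < c"
  shows "frame K f"
proof (rule frameI)
  show "finite K" using assms sys.finite_I finite_subset by blast
  show "y = 0" if "\<And>i. i \<in> K \<Longrightarrow> hinner y (f i) = 0" for y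
    using assms that by (auto simp: sys.balanced_def dest: spec[of _ y])
qed

lemma sum_hinner_scaled:
  assumes "\<And>i. i \<in> K \<Longrightarrow> 0 \<le> w i"
  shows "(\<Sum>i\<in>K. (norm (hinner x (scaled w f i)))\<^sup>2)
    = (\<Sum>i\<in>K. w i * (norm (hinner x (f i)))\<^sup>2)"
  using assms by (simp add: norm_hinner_scaled)

lemma frame_scaled_if_balanced:
  assumes "K \<subseteq> I" "\<And>i. i \<in> K \<Longrightarrow> 0 \<le> w i" "sys.balanced K w c" "0 < c"
  shows "frame K (scaled w f)"
proof (rule frameI)
  show "finite K" using assms sys.finite_I finite_subset by blast
  show "y = 0" if "\<And>i. i \<in> K \<Longrightarrow> hinner y (scaled w f i) = 0" for y
  proof -
    have "c * (norm y)\<^sup>2 = (\<Sum>i\<in>K. (norm (hinner y (scaled w f i)))\<^sup>2)"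
      using assms(2,3) by (simp add: sum_hinner_scaled sys.balanced_def)
    then show ?thesis using that assms(4) by simp
  qed
qed

lemma tight_frame_scaled_iff:
  assumes "K \<subseteq> I" "\<And>i. i \<in> K \<Longrightarrow> 0 \<le> w i"
  shows "tight_frame K (scaled w f) \<longleftrightarrow> (\<exists>c>0. sys.balanced K w c)"
  using frame_scaled_if_balanced[OF assms] assms(2)
  by (auto simp: tight_frame_def sum_hinner_scaled sys.balanced_def)

lemma scaling_iff:
  assumes "K \<subseteq> I"
  shows "scaling K f w \<longleftrightarrow> (\<forall>i\<in>K. 0 \<le> w i) \<and> sys.balanced K w 1"
  using frame_scaled_if_balanced[OF assms, of w 1]
  by (auto simp: scaling_def parseval_frame_def sum_hinner_scaled sys.balanced_def)

lemma scalability_poset_eq: "scalability_poset I f = sys.solvable"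
proof -
  have "scalable_frame J f \<longleftrightarrow> (\<exists>w. (\<forall>i\<in>J. 0 \<le> w i) \<and> sys.balanced J w 1)"
    if "J \<subseteq> I" for J
    unfolding scalable_frame_def scaling_iff[OF that]
    using frame_if_balanced[OF that] zero_less_one by blast
  then show ?thesis unfolding scalability_poset_def sys.solvable_def by blast
qed

text \<open>A strict scaling is assumed to exist, as otherwise the left side holds vacuously while a
  partition may fail to exist: for e1, e2 and (e1 + e2) / sqrt 2 in the real plane the empty cover
  is the single set {1, 2}.\<close>

lemma no_prime_strict_scaling_iff:
  assumes "\<exists>w. strict_scaling I f w"
  shows "\<not> (\<exists>w. strict_scaling I f w \<and> prime_scaling I f w) \<longleftrightarrow>
    (\<exists>A B. index_disjoint_partition (empty_cover (scalability_poset I f)) A B)"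
proof -
  have strict: "strict_scaling I f w \<longleftrightarrow> (\<forall>i\<in>I. 0 < w i) \<and> sys.balanced I w 1" for w
    by (auto simp: strict_scaling_def scaling_iff less_imp_le)
  have prime: "prime_scaling I f w \<longleftrightarrow> \<not> (\<exists>K\<subset>I. \<exists>c>0. sys.balanced K w c)"
    if "strict_scaling I f w" for w
  proof -
    have "tight_frame K (scaled w f) \<longleftrightarrow> (\<exists>c>0. sys.balanced K w c)" if "K \<subset> I" for K
      using that \<open>strict_scaling I f w\<close> strict
      by (intro tight_frame_scaled_iff) (auto intro: less_imp_le)
    then show ?thesis
      using that by (auto simp: prime_scaling_def strict_scaling_def)
  qed
  obtain w\<^sub>0 where w0: "\<forall>i\<in>I. 0 < w\<^sub>0 i" "sys.balanced I w\<^sub>0 1"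
    using assms strict by blast
  have "(\<exists>A B. index_disjoint_partition (empty_cover sys.solvable) A B) \<longleftrightarrow>
      (\<forall>w. strict_scaling I f w \<longrightarrow> (\<exists>K\<subset>I. \<exists>c>0. sys.balanced K w c))"
    unfolding strict by (rule sys.partition_iff) (use w0 in auto)
  then show ?thesis unfolding scalability_poset_eq using prime by meson
qed

end

theorem theorem13:
  fixes f :: "nat \<Rightarrow> real ^ 'n" and g :: "nat \<Rightarrow> complex ^ 'm" and k :: nat
  shows
    "(unit_norm_frame {1..k} f \<and> (\<exists>w. strict_scaling {1..k} f w) \<longrightarrow>
      (\<not> (\<exists>w. strict_scaling {1..k} f w \<and> prime_scaling {1..k} f w) \<longleftrightarrow>
       (\<exists>A B. index_disjoint_partition (empty_cover (scalability_poset {1..k} f)) A B))) \<and>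
     (unit_norm_frame {1..k} g \<and> (\<exists>w. strict_scaling {1..k} g w) \<longrightarrow>
      (\<not> (\<exists>w. strict_scaling {1..k} g w \<and> prime_scaling {1..k} g w) \<longleftrightarrow>
       (\<exists>A B. index_disjoint_partition (empty_cover (scalability_poset {1..k} g)) A B)))"
  using no_prime_strict_scaling_iff[of "{1..k}" f] no_prime_strict_scaling_iff[of "{1..k}" g]
  by simp

end
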